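(* Let $\tau>0$ and let $\mathcal{X}=I_1\times\cdots\times I_n\subset\mathbb{R}^n$ with $I_i\in T_1\cup T_2$ for every $i$. Let $\mathcal{X}_\tau(x)=\tau\|x\|_1+\delta_{\mathcal{X}}(x)$ for $x\in\mathbb{R}^n$. Then for every $v\in\mathbb{R}^n$, $$[\tau\cdot\mathrm{shrink}(\tau^{-1}v)]_{\mathcal{X}}^+=\mathrm{prox}_{\mathcal{X}_\tau(\cdot)}(v).$$
   Context: $T_1$ is the class of intervals of one of the forms $[c,\infty)$ with $c>0$; $(-\infty,c]$ with $c<0$; $[c,d]$ with $0<c<d$; $[d,c]$ with $d<c<0$. $T_2$ is the class of intervals $[c,d]$ with $c<0<d$. For a nonempty closed convex set $C$, $[x]_{C}^+=\arg\min_{y\in C}\|x-y\|_2$ is the Euclidean projection. The shrinkage operator is $\mathrm{shrink}(s)=\mathrm{sign}(s)\max\{|s|-1,0\}$ for $s\in\mathbb{R}$, applied componentwise to vectors. The projected shrinkage operator on the box $\mathcal{X}$ acts componentwise: $\left([\mathrm{shrink}(v)]_{\mathcal{X}}^+\right)_i=[\mathrm{shrink}(v_i)]_{I_i}^+$, and likewise $\left([\tau\cdot\mathrm{shrink}(\tau^{-1}v)]_{\mathcal{X}}^+\right)_i=[\tau\cdot\mathrm{shrink}(\tau^{-1}v_i)]_{I_i}^+$. $\delta_{\mathcal{X}}$ is the indicator function of $\mathcal{X}$ ($0$ on $\mathcal{X}$, $+\infty$ elsewhere). For a closed proper convex function $f:\mathbb{R}^n\to\mathbb{R}\cup\{+\infty\}$,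 $\mathrm{prox}_f(v)=\arg\min_x\left(f(x)+\frac12\|x-v\|_2^2\right)$. *)

theory Defs
  imports "HOL-Analysis.Analysis"
begin

definition T1 :: "real set set" where
  "T1 = {{c..} | c. c > 0} \<union> {{..c} | c. c < 0}
      \<union> {{c..d} | c d. 0 < c \<and> c < d} \<union> {{d..c} | c d. d < c \<and> c < 0}"

definition T2 :: "real set set" where
  "T2 = {{c..d} | c d. c < 0 \<and> 0 < d}"

definition box_prod :: "('n::finite \<Rightarrow> real set) \<Rightarrow> (real ^ 'n) set" where
  "box_prod I = {x. \<forall>i. x $ i \<in> I i}"

definition shrink :: "real \<Rightarrow> real" where
  "shrink s = sgn s * max (\<bar>s\<bar> - 1) 0"

definition shrink_vec :: "real ^ 'n \<Rightarrow> real ^ 'n" where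
  "shrink_vec v = (\<chi> i. shrink (v $ i))"

definition l1_norm :: "real ^ 'n \<Rightarrow> real" where
  "l1_norm x = (\<Sum>i\<in>UNIV. \<bar>x $ i\<bar>)"

(* The convex-analysis indicator (0 on C, infinity off C), not the 0/1-valued
   characteristic function called "indicator" in the library. *)
definition delta :: "'a set \<Rightarrow> 'a \<Rightarrow> ereal" where
  "delta C x = (if x \<in> C then 0 else \<infinity>)"

(* As with closest_point, the value is meaningful when the minimizer exists and is unique;
   this holds for every closed proper convex f. *)
definition prox :: "(real ^ 'n \<Rightarrow> ereal) \<Rightarrow> real ^ 'n \<Rightarrow> real ^ 'n" where
  "prox f v = (ARG_MIN (\<lambda>x. f x + ereal (1 / 2 * (norm (x - v))\<^sup>2)) x. True)"

lemma prox_eqI: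
  assumes "\<And>y. y \<noteq> x \<Longrightarrow>
    f x + ereal (1 / 2 * (norm (x - v))\<^sup>2) < f y + ereal (1 / 2 * (norm (y - v))\<^sup>2)"
  shows "prox f v = x"
  unfolding prox_def arg_min_def is_arg_min_def
proof (rule some_equality)
  show "True \<and> \<not> (\<exists>y. True \<and> f y + ereal (1 / 2 * (norm (y - v))\<^sup>2)
      < f x + ereal (1 / 2 * (norm (x - v))\<^sup>2))"
    using assms by (metis less_asym less_irrefl)
qed (use assms in blast)

definition X_tau :: "(real ^ 'n) set \<Rightarrow> real \<Rightarrow> real ^ 'n \<Rightarrow> ereal" where
  "X_tau X \<tau> x = ereal (\<tau> * l1_norm x) + delta X x"

lemma T1_T2_interval:
  assumes "J \<in> T1 \<union> T2"
  shows "closed J" "convex J" "J \<noteq> {}"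
  using assms unfolding T1_def T2_def by auto

lemma closest_point_box_prod:
  fixes I :: "'n::finite \<Rightarrow> real set"
  assumes "\<And>i. closed (I i)" "\<And>i. convex (I i)" "\<And>i. I i \<noteq> {}"
  shows "closest_point (box_prod I) w $ i = closest_point (I i) (w $ i)"
proof -
  let ?p = "\<chi> i. closest_point (I i) (w $ i)"
  have "convex (box_prod I)"
    using assms(2) unfolding box_prod_def convex_def by simp
  moreover have "closed (box_prod I)"
  proof -
    have "closed ((\<lambda>x::real^'n. x $ j) -` I j)" for j
      by (intro continuous_closed_vimage assms continuous_intros)
    moreover have "box_prod I = (\<Inter>j. (\<lambda>x. x $ j) -` I j)"
      unfolding box_prod_def by auto
    ultimately show ?thesis by auto
  qed
  moreover have "?p \<in> box_prod I"
    using assms by (simp add: box_prod_def closest_point_in_set)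
  moreover have "\<forall>z\<in>box_prod I. dist w ?p \<le> dist w z"
    using assms unfolding dist_vec_def box_prod_def
    by (auto intro!: L2_set_mono closest_point_le)
  ultimately have "?p = closest_point (box_prod I) w"
    by (rule closest_point_unique)
  then show ?thesis by (metis vec_lambda_beta)
qed

end

theory Submission
  imports Defs
begin

text \<open>
  The problem separates over the coordinates, so it is about an interval \<open>J\<close> on the line. Let
  \<open>s = \<tau> shrink (t / \<tau>)\<close>, so that \<open>t - s\<close> is a subgradient of \<open>\<tau>\<bar>\<cdot>\<bar>\<close> at \<open>s\<close>, and let \<open>p\<close> be the
  projection of \<open>s\<close> to \<open>J\<close>. If \<open>0 \<in> J\<close>, then \<open>p\<close> lies between \<open>0\<close> and \<open>s\<close>, where \<open>t - s\<close> is still a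
  subgradient; otherwise \<open>\<bar>\<cdot>\<bar>\<close> is linear on \<open>J\<close>. Either way the variational inequality of the
  projection gives the optimality of \<open>p\<close>, with a quadratic gain that yields uniqueness.
\<close>

lemma scaled_shrink:
  assumes "\<tau> > 0"
  shows "\<tau> * shrink (inverse \<tau> * t) = (if t > \<tau> then t - \<tau> else if t < - \<tau> then t + \<tau> else 0)"
  using assms by (auto simp: shrink_def sgn_if max_def abs_if field_simps)

text \<open>The three facts together place \<open>t - s\<close> in the subdifferential of
  \<open>\<tau> * \<bar>x\<bar>\<close> at \<open>x = s\<close>.\<close>

lemma shrink_residual:
  assumes "\<tau> > 0" and "s = \<tau> * shrink (inverse \<tau> * t)"
  shows "\<bar>t - s\<bar> \<le> \<tau>" and "s > 0 \<Longrightarrow> t - s = \<tau>" and "s < 0 \<Longrightarrow> t - s = - \<tau>"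
  using assms by (auto simp: scaled_shrink split: if_splits)

lemma convex_real_zero_notin_same_sign:
  fixes J :: "real set"
  assumes "convex J" "0 \<notin> J" "p \<in> J" "y \<in> J"
  shows "(0 < p \<and> 0 < y) \<or> (p < 0 \<and> y < 0)"
proof -
  have J: "is_interval J"
    using assms(1) by (simp add: is_interval_convex_1)
  have "p \<noteq> 0" "y \<noteq> 0" "\<not> (p \<le> 0 \<and> 0 \<le> y)" "\<not> (y \<le> 0 \<and> 0 \<le> p)"
    using assms mem_is_interval_1_I[OF J] by blast+
  then show ?thesis by linarith
qed

lemma closest_point_shrink_optimal:
  fixes J :: "real set" and t :: real
  assumes \<tau>: "\<tau> > 0" and J: "closed J" "convex J" "y \<in> J"
  defines "p \<equiv> closest_point J (\<tau> * shrink (inverse \<tau> * t))"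
  shows "\<tau> * \<bar>p\<bar> + 1 / 2 * (p - t)\<^sup>2 + 1 / 2 * (y - p)\<^sup>2 \<le> \<tau> * \<bar>y\<bar> + 1 / 2 * (y - t)\<^sup>2"
proof -
  define s where "s = \<tau> * shrink (inverse \<tau> * t)"
  note res = shrink_residual[OF \<tau> s_def]
  have pJ: "p \<in> J"
    unfolding p_def using J by (intro closest_point_in_set) auto
  have var: "(s - p) * (z - p) \<le> 0" if "z \<in> J" for z
    using closest_point_dot[OF J(2,1) that, of s] by (simp add: p_def s_def)
  \<comment> \<open>Expanding \<open>(y - t)\<^sup>2\<close> around \<open>p\<close> shows that this
    is equivalent to the goal.\<close>
  have main: "(t - p) * (y - p) \<le> \<tau> * \<bar>y\<bar> - \<tau> * \<bar>p\<bar>"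
  proof (cases "0 \<in> J")
    case True
    \<comment> \<open>Testing \<open>var\<close> at \<open>z = 0\<close> shows that \<open>p\<close>
      is zero or has the sign of \<open>s\<close>.\<close>
    have "s * p \<ge> p * p"
      using var[OF True] by (simp add: algebra_simps)
    then have "p = 0 \<or> 0 < s * p"
      by (metis not_real_square_gt_zero order_less_le_trans)
    then have "(t - s) * p = \<tau> * \<bar>p\<bar>"
      by (auto simp: zero_less_mult_iff res)
    moreover have "(t - s) * y \<le> \<tau> * \<bar>y\<bar>"
      using mult_right_mono[OF res(1) abs_ge_zero[of y]] abs_ge_self[of "(t - s) * y"]
      by (simp add: abs_mult)
    ultimately show ?thesis
      using var[OF J(3)] by (simp add: algebra_simps)
  next
    case False
    from convex_real_zero_notin_same_sign[OF J(2) False pJ J(3)]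
    consider "0 < p" "0 < y" | "p < 0" "y < 0" by blast
    then show ?thesis
    proof cases
      case 1
      \<comment> \<open>Split \<open>t - p\<close> as \<open>(t - s) + (s - p)\<close>:
        \<open>var\<close> bounds the second part, this the first. If \<open>s \<le> 0 < p\<close>,
        then \<open>var\<close> forces \<open>p \<le> y\<close>.\<close>
      have "(\<tau> - (t - s)) * (y - p) \<ge> 0"
      proof (cases "s > 0")
        case False
        then have "y \<ge> p"
          using var[OF J(3)] 1 by (simp add: mult_le_0_iff)
        then show ?thesis using res(1) by simp
      qed (simp add: res)
      then show ?thesis
        using var[OF J(3)] 1 by (simp add: algebra_simps)
    next
      case 2
      have "(\<tau> + (t - s)) * (p - y) \<ge> 0"
      proof (cases "s < 0")
        case False
        then have "y \<le> p"
          using var[OF J(3)] 2 by (simp add: mult_le_0_iff)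
        then show ?thesis using res(1) by simp
      qed (simp add: res)
      then show ?thesis
        using var[OF J(3)] 2 by (simp add: algebra_simps)
    qed
  qed
  then show ?thesis
    by (simp add: power2_eq_square field_simps)
qed

lemma norm_vec_power2: "(norm (x :: real ^ 'n))\<^sup>2 = (\<Sum>i\<in>UNIV. (x $ i)\<^sup>2)"
  by (simp add: norm_vec_def L2_set_def sum_nonneg)

theorem corollary1:
  fixes \<tau> :: real
    and I :: "'n::finite \<Rightarrow> real set"
    and X :: "(real ^ 'n) set"
  assumes "\<tau> > 0"
    and "\<And>i. I i \<in> T1 \<union> T2"
    and "X = box_prod I"
  shows "\<forall>v :: real ^ 'n.
    closest_point X (\<tau> *\<^sub>R shrink_vec (inverse \<tau> *\<^sub>R v)) = prox (X_tau X \<tau>) v"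
proof
  fix v :: "real ^ 'n"
  note I = T1_T2_interval[OF assms(2)]
  define p where "p = closest_point X (\<tau> *\<^sub>R shrink_vec (inverse \<tau> *\<^sub>R v))"
  have p_nth: "p $ i = closest_point (I i) (\<tau> * shrink (inverse \<tau> * v $ i))" for i
    unfolding p_def assms(3) by (subst closest_point_box_prod[OF I]) (simp add: shrink_vec_def)
  have pX: "p \<in> X"
    using I by (simp add: assms(3) box_prod_def p_nth closest_point_in_set)
  have "prox (X_tau X \<tau>) v = p"
  proof (rule prox_eqI)
    fix y assume "y \<noteq> p"
    show "X_tau X \<tau> p + ereal (1 / 2 * (norm (p - v))\<^sup>2)
        < X_tau X \<tau> y + ereal (1 / 2 * (norm (y - v))\<^sup>2)"
    proof (cases "y \<in> X")
      case True
      have "\<tau> * l1_norm p + 1 / 2 * (norm (p - v))\<^sup>2 + 1 / 2 * (norm (y - p))\<^sup>2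
          = (\<Sum>i\<in>UNIV. \<tau> * \<bar>p $ i\<bar> + 1 / 2 * (p $ i - v $ i)\<^sup>2 + 1 / 2 * (y $ i - p $ i)\<^sup>2)"
        by (simp add: l1_norm_def norm_vec_power2 sum.distrib sum_distrib_left sum_divide_distrib)
      also have "\<dots> \<le> (\<Sum>i\<in>UNIV. \<tau> * \<bar>y $ i\<bar> + 1 / 2 * (y $ i - v $ i)\<^sup>2)"
        using True unfolding p_nth
        by (intro sum_mono closest_point_shrink_optimal assms I) (simp add: assms(3) box_prod_def)
      also have "\<dots> = \<tau> * l1_norm y + 1 / 2 * (norm (y - v))\<^sup>2"
        by (simp add: l1_norm_def norm_vec_power2 sum.distrib sum_distrib_left sum_divide_distrib)
      finally have "\<tau> * l1_norm p + 1 / 2 * (norm (p - v))\<^sup>2 + 1 / 2 * (norm (y - p))\<^sup>2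
          \<le> \<tau> * l1_norm y + 1 / 2 * (norm (y - v))\<^sup>2" .
      \<comment> \<open>The quadratic gain makes the inequality strict, which identifies the point
        chosen by \<open>prox\<close>.\<close>
      moreover have "(norm (y - p))\<^sup>2 > 0"
        using \<open>y \<noteq> p\<close> by simp
      ultimately have "\<tau> * l1_norm p + 1 / 2 * (norm (p - v))\<^sup>2
          < \<tau> * l1_norm y + 1 / 2 * (norm (y - v))\<^sup>2"
        by linarith
      then show ?thesis
        using True pX by (simp add: X_tau_def delta_def)
    \<comment> \<open>Outside \<open>X\<close> the objective is infinite, while at \<open>p\<close>
      it is finite.\<close>
    qed (simp add: X_tau_def delta_def pX)
  qed
  then show "closest_point X (\<tau> *\<^sub>R shrink_vec (inverse \<tau> *\<^sub>R v)) = prox (X_tau X \<tau>) v"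
    by (simp add: p_def)
qed

end
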